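(* Let $n\ge 1$. There is a bijection between the set of coloring vectors in $\mathbb{Z}^n$ and the set of polydiagonal subspaces of $\mathbb{R}^n$, given by $c\mapsto\Delta_{\mathcal{P}_c}$, where $$\Delta_{\mathcal{P}_c}=\{x\in\mathbb{R}^n\mid x_i=x_j\text{ if }c_i=c_j\text{ and }x_i=-x_j\text{ if }c_i=-c_j\}$$ (with $i,j$ ranging over $\{1,\ldots,n\}$, $i=j$ allowed).
   Context: An element $c\in\mathbb{Z}^n$ is a coloring vector if $c_1\in\{0,1\}$ and $-m_i\le c_i\le 1+m_i$ for all $i\in\{2,\ldots,n\}$, where $m_i:=\max\{c_1,\ldots,c_{i-1}\}$. A partial involution on a set $X$ is a function $x\mapsto x^*:\tilde X\to\tilde X$ defined on a subset $\tilde X\subseteq X$ that is its own inverse ($x^{**}=x$). A tagged partition of a finite set $C$ is a partition $\mathcal{P}$ of $C$ together with a partial involution $P\mapsto P^*:\tilde{\mathcal{P}}\to\tilde{\mathcal{P}}$ on $\mathcal{P}$ (with $\tilde{\mathcal{P}}\subseteq\mathcal{P}$) that has at most one fixed point. The class of $i\in C$ is denoted $[i]$. The polydiagonal subspace of a tagged partition $\mathcal{P}$ of $\{1,\ldots,n\}$ is $\Delta_{\mathcal{P}}:=\{x\in\mathbb{R}^n\mid x_i=x_j\text{ if }[i]=[j]\text{ and }x_i=-x_j\text{ if }[i]^*=[j]\}$ (where $i=j$ is allowed, so $[i]^*=[i]$ forces $x_i=0$). A subspace of $\mathbb{R}^n$ is called polydiagonal if it equals $\Delta_{\mathcal{P}}$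 for some tagged partition $\mathcal{P}$ of $\{1,\ldots,n\}$. For a coloring vector $c$, $\mathcal{P}_c$ is the partition of $\{1,\ldots,n\}$ into the classes $[i]=\{j\mid c_j=c_i\}$, tagged with the partial involution $[i]\mapsto[i]^*:=\{j\mid c_j=-c_i\}$ defined on those classes for which $[i]^*\neq\emptyset$. *)

theory Defs
  imports "HOL-Analysis.Analysis" "HOL-Library.Disjoint_Sets"
begin

text \<open>
  The index set \<open>{1, \<dots>, n}\<close> is the universe of a finite linearly ordered type \<open>'n\<close>,
  with \<open>n = CARD('n) \<ge> 1\<close>; the order matters only for coloring vectors.
  The smallest index \<open>Min UNIV\<close> plays the role of 1.
\<close>

definition coloring_vector :: "int ^ 'n::{finite,linorder} \<Rightarrow> bool" where
  "coloring_vector c \<longleftrightarrow>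
     c $ Min UNIV \<in> {0, 1} \<and>
     (\<forall>i. i \<noteq> Min UNIV \<longrightarrow>
        (let m = Max {c $ j | j. j < i} in - m \<le> c $ i \<and> c $ i \<le> 1 + m))"

text \<open>
  A partial involution on \<open>X\<close> is a partial map whose domain is the subset on which the
  involution is defined; that it maps its domain to itself follows from the second clause.
\<close>

definition partial_involution_on :: "'a set \<Rightarrow> ('a \<rightharpoonup> 'a) \<Rightarrow> bool" where
  "partial_involution_on X s \<longleftrightarrow>
     dom s \<subseteq> X \<and> (\<forall>x y. s x = Some y \<longrightarrow> s y = Some x)"

definition tagged_partition_on :: "'a set \<Rightarrow> 'a set set \<Rightarrow> ('a set \<rightharpoonup> 'a set) \<Rightarrow> bool" where
  "tagged_partition_on C P s \<longleftrightarrow>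
     partition_on C P \<and> partial_involution_on P s \<and>
     (\<forall>A B. s A = Some A \<longrightarrow> s B = Some B \<longrightarrow> A = B)"

definition class_of :: "'a set set \<Rightarrow> 'a \<Rightarrow> 'a set" where
  "class_of P i = (THE A. A \<in> P \<and> i \<in> A)"

definition polydiag ::
  "'n set set \<Rightarrow> ('n set \<rightharpoonup> 'n set) \<Rightarrow> (real ^ 'n::finite) set" where
  "polydiag P s =
     {x. \<forall>i j. (class_of P i = class_of P j \<longrightarrow> x $ i = x $ j) \<and>
               (s (class_of P i) = Some (class_of P j) \<longrightarrow> x $ i = - x $ j)}"

definition polydiagonal :: "(real ^ 'n::finite) set \<Rightarrow> bool" where
  "polydiagonal S \<longleftrightarrow>
     subspace S \<and> (\<exists>P s. tagged_partition_on UNIV P s \<and> S = polydiag P s)"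

definition color_partition :: "int ^ 'n::finite \<Rightarrow> 'n set set" where
  "color_partition c = {{j. c $ j = c $ i} | i. True}"

text \<open>
  All \<open>i \<in> A\<close> have the same color when \<open>A\<close> is a class of \<open>color_partition c\<close>,
  so the set below is \<open>{j. c $ j = - c $ i}\<close> for any such \<open>i\<close>.
\<close>

definition color_tag :: "int ^ 'n::finite \<Rightarrow> 'n set \<rightharpoonup> 'n set" where
  "color_tag c A =
     (let B = {j. \<exists>i\<in>A. c $ j = - c $ i}
      in if A \<in> color_partition c \<and> B \<noteq> {} then Some B else None)"

lemma color_tag_class:
  "color_tag c {j. c $ j = c $ i} =
     (if {j. c $ j = - c $ i} \<noteq> {} then Some {j. c $ j = - c $ i} else None)"
proof -
  have "{j. \<exists>k\<in>{j. c $ j = c $ i}. c $ j = - c $ k} = {j. c $ j = - c $ i}" by auto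
  then show ?thesis by (auto simp: color_tag_def color_partition_def Let_def)
qed

lemma tagged_partition_on_color: "tagged_partition_on UNIV (color_partition c) (color_tag c)"
proof -
  have part: "partition_on UNIV (color_partition c)"
    by (rule partition_onI) (auto simp: color_partition_def disjnt_def)
  have dom: "A \<in> color_partition c" if "color_tag c A = Some B" for A B
    using that by (auto simp: color_tag_def Let_def split: if_splits)
  have inv: "color_tag c B = Some A" if AB: "color_tag c A = Some B" for A B
  proof -
    obtain i where A: "A = {j. c $ j = c $ i}"
      using dom[OF AB] by (auto simp: color_partition_def)
    have B: "B = {j. c $ j = - c $ i}" and ne: "B \<noteq> {}"
      using AB by (auto simp: A color_tag_class split: if_splits)
    obtain k where k: "c $ k = - c $ i" using B ne by auto
    have B': "B = {j. c $ j = c $ k}" and A': "A = {j. c $ j = - c $ k}"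
      unfolding A B k by simp_all
    have "i \<in> A" using A by simp
    then have "{j. c $ j = - c $ k} \<noteq> {}" unfolding A' by (metis empty_iff)
    then show ?thesis unfolding A' B' color_tag_class by (rule if_P)
  qed
  have fixpoint: "A = {j. c $ j = 0}" if AA: "color_tag c A = Some A" for A
  proof -
    obtain i where A: "A = {j. c $ j = c $ i}"
      using dom[OF AA] by (auto simp: color_partition_def)
    have "A = {j. c $ j = - c $ i}"
      using AA by (auto simp: A color_tag_class split: if_splits)
    moreover have "i \<in> A" using A by simp
    ultimately have "i \<in> {j. c $ j = - c $ i}" by (rule subst)
    then have "c $ i = - c $ i" by simp
    then show ?thesis using A by simp
  qed
  show ?thesis
    unfolding tagged_partition_on_def partial_involution_on_def
  proof (intro conjI allI impI part)
    show "dom (color_tag c) \<subseteq> color_partition c" using dom by (auto simp: dom_def)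
  next
    fix A B assume "color_tag c A = Some B"
    then show "color_tag c B = Some A" by (rule inv)
  next
    fix A B assume "color_tag c A = Some A" "color_tag c B = Some B"
    then show "A = B" using fixpoint by metis
  qed
qed

lemma subspace_polydiag: "subspace (polydiag P s)"
proof (rule subspaceI)
  show "0 \<in> polydiag P s" by (simp add: polydiag_def)
next
  fix x y assume x: "x \<in> polydiag P s" and y: "y \<in> polydiag P s"
  show "x + y \<in> polydiag P s"
    unfolding polydiag_def
  proof (intro CollectI allI conjI impI)
    fix i j assume "class_of P i = class_of P j"
    then have "x $ i = x $ j" "y $ i = y $ j" using x y unfolding polydiag_def by blast+
    then show "(x + y) $ i = (x + y) $ j" by simp
  next
    fix i j assume "s (class_of P i) = Some (class_of P j)"
    then have "x $ i = - x $ j" "y $ i = - y $ j" using x y unfolding polydiag_def by blast+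
    then show "(x + y) $ i = - (x + y) $ j" by simp
  qed
next
  fix r x assume x: "x \<in> polydiag P s"
  show "r *\<^sub>R x \<in> polydiag P s"
    unfolding polydiag_def
  proof (intro CollectI allI conjI impI)
    fix i j assume "class_of P i = class_of P j"
    then have "x $ i = x $ j" using x unfolding polydiag_def by blast
    then show "(r *\<^sub>R x) $ i = (r *\<^sub>R x) $ j" by simp
  next
    fix i j assume "s (class_of P i) = Some (class_of P j)"
    then have "x $ i = - x $ j" using x unfolding polydiag_def by blast
    then show "(r *\<^sub>R x) $ i = - (r *\<^sub>R x) $ j" by simp
  qed
qed

end

(* A set S of vectors determines the relations "x_i = x_j on S" and "x_i = -x_j on S".  For the
   subspace of c these are exactly c_i = c_j and c_i = -c_j, because c itself lies in it; and a
   polydiagonal subspace is recovered from its two relations.  So a coloring vector has to be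
   found for each such pair of relations, and shown to be unique: color the indices in increasing
   order, giving 0 to those with x_i = -x_i and the next unused positive number to the first index
   of every other class up to sign. *)
theory Submission
  imports Defs
begin

section \<open>Relations read off from the subspace of an integer vector\<close>

definition color_subspace :: "int ^ 'n::finite \<Rightarrow> (real ^ 'n) set" where
  "color_subspace c = {x. \<forall>i j. (c $ i = c $ j \<longrightarrow> x $ i = x $ j) \<and>
                                 (c $ i = - c $ j \<longrightarrow> x $ i = - x $ j)}"

lemma class_of_color_partition: "class_of (color_partition c) i = {j. c $ j = c $ i}"
  unfolding class_of_def color_partition_def by (rule the_equality) auto

lemma polydiag_color: "polydiag (color_partition c) (color_tag c) = color_subspace c"
proof -
  have eq: "{k. c $ k = c $ i} = {k. c $ k = c $ j} \<longleftrightarrow> c $ i = c $ j" for i j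
    by auto
  have neg: "color_tag c {k. c $ k = c $ i} = Some {k. c $ k = c $ j} \<longleftrightarrow> c $ i = - c $ j" for i j
  proof -
    have "{k. c $ k = - c $ i} = {k. c $ k = c $ j} \<longleftrightarrow> c $ i = - c $ j"
      by (auto simp: set_eq_iff)
    \<comment> \<open>The tag is \<open>None\<close> when the opposite class is empty; the class of
      \<open>j\<close> contains \<open>j\<close>, so it cannot be that empty opposite class.\<close>
    moreover have "{k. c $ k = c $ j} \<noteq> {}"
      by auto
    ultimately show ?thesis
      unfolding color_tag_class by (metis option.inject option.distinct(1))
  qed
  show ?thesis
    unfolding polydiag_def color_subspace_def class_of_color_partition eq neg ..
qed

lemma of_int_vec_in_color_subspace: "(\<chi> i. of_int (c $ i)) \<in> color_subspace c"
  by (simp add: color_subspace_def)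

lemma color_subspace_eq_iff: "(\<forall>x\<in>color_subspace c. x $ i = x $ j) \<longleftrightarrow> c $ i = c $ j"
proof
  assume "\<forall>x\<in>color_subspace c. x $ i = x $ j"
  from bspec[OF this of_int_vec_in_color_subspace] show "c $ i = c $ j"
    by simp
qed (unfold color_subspace_def, blast)

lemma color_subspace_neg_iff: "(\<forall>x\<in>color_subspace c. x $ i = - x $ j) \<longleftrightarrow> c $ i = - c $ j"
proof
  assume "\<forall>x\<in>color_subspace c. x $ i = - x $ j"
  from bspec[OF this of_int_vec_in_color_subspace] have "real_of_int (c $ i) = - of_int (c $ j)"
    by simp
  then show "c $ i = - c $ j"
    by linarith
qed (unfold color_subspace_def, blast)

section \<open>Coloring vectors and their running maximum\<close>

text \<open>The added 0 makes the bounds on \<open>c $ i\<close> uniform, including the smallest index.\<close>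

definition color_max :: "int ^ 'n::{finite,linorder} \<Rightarrow> 'n \<Rightarrow> int" where
  "color_max c i = Max (insert 0 {c $ j | j. j < i})"

lemma color_max_nonneg: "0 \<le> color_max c i"
  by (simp add: color_max_def)

lemma color_max_ge: "j < i \<Longrightarrow> c $ j \<le> color_max c i"
  unfolding color_max_def by (rule Max_ge) auto

lemma color_max_attained:
  assumes "0 < color_max c i"
  obtains j where "j < i" "c $ j = color_max c i"
proof -
  have "color_max c i \<in> insert 0 {c $ j | j. j < i}"
    unfolding color_max_def by (rule Max_in) auto
  then show ?thesis using assms that by auto
qed

text \<open>At the smallest index the maximum is 0 and the bounds say exactly 0 or 1. The first
  entry is then nonnegative and occurs before every other index, so inserting 0 does not change the
  later maxima.\<close>

lemma coloring_vector_iff: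
  fixes c :: "int ^ 'n::{finite,linorder}"
  shows "coloring_vector c \<longleftrightarrow> (\<forall>i. - color_max c i \<le> c $ i \<and> c $ i \<le> 1 + color_max c i)"
proof -
  let ?o = "Min (UNIV :: 'n set)"
  have o_le: "?o \<le> i" for i :: 'n
    by simp
  have o_max: "color_max c ?o = 0"
    using o_le by (simp add: color_max_def flip: not_le)
  have o_iff: "c $ ?o \<in> {0, 1} \<longleftrightarrow> - color_max c ?o \<le> c $ ?o \<and> c $ ?o \<le> 1 + color_max c ?o"
    by (auto simp: o_max)
  have max_eq: "Max {c $ j | j. j < i} = color_max c i" if "0 \<le> c $ ?o" "i \<noteq> ?o" for i
  proof -
    have "?o < i"
      using o_le[of i] that(2) by (simp only: order_less_le) auto
    then have ne: "c $ ?o \<in> {c $ j | j. j < i}" by blast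
    have "0 \<le> Max {c $ j | j. j < i}"
      using that(1) by (rule order_trans) (use ne in \<open>auto intro!: Max_ge\<close>)
    moreover have "color_max c i = max 0 (Max {c $ j | j. j < i})"
      unfolding color_max_def using ne by (subst Max_insert) auto
    ultimately show ?thesis by simp
  qed
  let ?B = "\<lambda>i. - color_max c i \<le> c $ i \<and> c $ i \<le> 1 + color_max c i"
  show ?thesis
  proof
    assume c: "coloring_vector c"
    then have o: "c $ ?o \<in> {0, 1}"
      unfolding coloring_vector_def by blast
    then have o_nonneg: "0 \<le> c $ ?o" by auto
    have "?B i" if "i \<noteq> ?o" for i
      using c that unfolding coloring_vector_def Let_def max_eq[OF o_nonneg that, symmetric] by blast
    moreover have "?B ?o"
      using o unfolding o_iff .
    ultimately show "\<forall>i. ?B i"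
      by metis
  next
    assume c: "\<forall>i. ?B i"
    then have o: "c $ ?o \<in> {0, 1}"
      unfolding o_iff by (rule spec)
    then have o_nonneg: "0 \<le> c $ ?o" by auto
    show "coloring_vector c"
      unfolding coloring_vector_def Let_def
    proof (intro conjI allI impI o)
      fix i assume "i \<noteq> ?o"
      then show "- Max {c $ j | j. j < i} \<le> c $ i" "c $ i \<le> 1 + Max {c $ j | j. j < i}"
        unfolding max_eq[OF o_nonneg \<open>i \<noteq> ?o\<close>] using c by blast+
    qed
  qed
qed

text \<open>Finiteness makes the order well-founded: the number of smaller elements
  decreases.\<close>

lemma finite_less_induct [case_names less]:
  fixes i :: "'n::{finite,linorder}"
  assumes "\<And>i. (\<And>j. j < i \<Longrightarrow> P j) \<Longrightarrow> P i"
  shows "P i"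
proof (induction "card {..<i}" arbitrary: i rule: less_induct)
  case less
  have "card {..<j} < card {..<i}" if "j < i" for j
    using that by (intro psubset_card_mono) auto
  then show ?case
    using assms less by blast
qed

text \<open>The running maximum grows by at most 1 per index, so no positive color is
  skipped.\<close>

lemma coloring_vector_attains:
  fixes c :: "int ^ 'n::{finite,linorder}"
  assumes c: "coloring_vector c" and k: "0 < k" "k \<le> color_max c i"
  shows "\<exists>j<i. c $ j = k"
  using k(2)
proof (induction i rule: finite_less_induct)
  case (less i)
  obtain j where j: "j < i" "c $ j = color_max c i"
    using color_max_attained k(1) less.prems by (metis order_less_le_trans)
  show ?case
  proof (cases "k = c $ j")
    case False
    \<comment> \<open>Here \<open>k < c $ j\<close> and
      \<open>c $ j \<le> 1 + color_max c j\<close>, so the search continues below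
      \<open>j\<close>.\<close>
    then have "k \<le> color_max c j"
      using less.prems j c unfolding coloring_vector_iff by (smt (verit))
    then show ?thesis
      using less.IH j(1) by (meson order_less_trans)
  qed (use j in auto)
qed

section \<open>Uniqueness of the coloring vector\<close>

lemma coloring_vector_new:
  assumes "coloring_vector a" "\<not> \<bar>a $ i\<bar> \<le> color_max a i"
  shows "a $ i = 1 + color_max a i"
proof -
  have "- color_max a i \<le> a $ i" "a $ i \<le> 1 + color_max a i"
    using assms(1) unfolding coloring_vector_iff by blast+
  then show ?thesis
    using assms(2) by linarith
qed

text \<open>The color 0 is detected by the negation relation of \<open>i\<close> with itself. Any
  other old color is, up to sign, the color of an earlier index, where \<open>a\<close> and
  \<open>b\<close> agree, and the relation to that index carries over to \<open>b\<close>.\<close>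

lemma coloring_vector_eq_old:
  fixes a b :: "int ^ 'n::{finite,linorder}"
  assumes a: "coloring_vector a" and le: "\<bar>a $ i\<bar> \<le> color_max a i"
    and eq: "\<And>j. a $ i = a $ j \<longleftrightarrow> b $ i = b $ j"
    and neg: "\<And>j. a $ i = - a $ j \<longleftrightarrow> b $ i = - b $ j"
    and ab: "\<And>j. j < i \<Longrightarrow> a $ j = b $ j"
  shows "a $ i = b $ i"
proof (cases "a $ i = 0")
  case True
  then show ?thesis using neg[of i] by simp
next
  case False
  then have "0 < \<bar>a $ i\<bar>" by simp
  then obtain j where j: "j < i" "a $ j = \<bar>a $ i\<bar>"
    using coloring_vector_attains[OF a _ le] by blast
  then consider "a $ i = a $ j" | "a $ i = - a $ j"
    by linarith
  then show ?thesis
  proof cases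
    case 1
    show ?thesis unfolding 1 ab[OF j(1)] using eq[THEN iffD1, OF 1] by (rule sym)
  next
    case 2
    show ?thesis unfolding 2 ab[OF j(1)] using neg[THEN iffD1, OF 2] by (rule sym)
  qed
qed

text \<open>Agreement on earlier indices gives equal running maxima \<open>m\<close>. An old color
  in either vector forces equality; otherwise both entries are the new color
  \<open>1 + m\<close>.\<close>

lemma coloring_vector_eqI:
  fixes c d :: "int ^ 'n::{finite,linorder}"
  assumes c: "coloring_vector c" and d: "coloring_vector d"
    and eq: "\<And>i j. c $ i = c $ j \<longleftrightarrow> d $ i = d $ j"
    and neg: "\<And>i j. c $ i = - c $ j \<longleftrightarrow> d $ i = - d $ j"
  shows "c = d"
proof -
  have "c $ i = d $ i" for i
  proof (induction i rule: finite_less_induct)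
    case (less i)
    have "(\<lambda>j. c $ j) ` {j. j < i} = (\<lambda>j. d $ j) ` {j. j < i}"
      by (rule image_cong) (simp_all add: less)
    then have m: "color_max d i = color_max c i"
      by (simp add: color_max_def setcompr_eq_image)
    show ?case
    proof (cases "\<bar>c $ i\<bar> \<le> color_max c i")
      case True
      then show ?thesis
        using eq neg less by (rule coloring_vector_eq_old[OF c])
    next
      case c_new: False
      show ?thesis
      proof (cases "\<bar>d $ i\<bar> \<le> color_max d i")
        case True
        then have "d $ i = c $ i"
          using eq[symmetric] neg[symmetric] less[symmetric] by (rule coloring_vector_eq_old[OF d])
        then show ?thesis ..
      next
        case False
        show ?thesis
          unfolding coloring_vector_new[OF c c_new] coloring_vector_new[OF d False] m ..
      qed
    qed
  qed
  then show ?thesis by (simp add: vec_eq_iff)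
qed

section \<open>Existence of the coloring vector\<close>

text \<open>Signs compose: two equalities or two negations give an equality, one of each gives a
  negation. So equality up to sign is an equivalence relation, and a color records the number of a
  class and the sign relative to its least member.\<close>

lemma exists_coloring_vector:
  fixes S :: "(real ^ 'n::{finite,linorder}) set"
  obtains c where "coloring_vector c"
    "\<And>i j. c $ i = c $ j \<longleftrightarrow> (\<forall>x\<in>S. x $ i = x $ j)"
    "\<And>i j. c $ i = - c $ j \<longleftrightarrow> (\<forall>x\<in>S. x $ i = - x $ j)"
proof -
  define R where "R i j \<longleftrightarrow> (\<forall>x\<in>S. x $ i = x $ j)" for i j
  define N where "N i j \<longleftrightarrow> (\<forall>x\<in>S. x $ i = - x $ j)" for i j
  have R_refl: "R i i" and R_sym: "R i j \<Longrightarrow> R j i" and N_sym: "N i j \<Longrightarrow> N j i"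
    and RR: "R i j \<Longrightarrow> R j k \<Longrightarrow> R i k" and RN: "R i j \<Longrightarrow> N j k \<Longrightarrow> N i k"
    and NR: "N i j \<Longrightarrow> R j k \<Longrightarrow> N i k" and NN: "N i j \<Longrightarrow> N j k \<Longrightarrow> R i k"
    for i j k by (auto simp: R_def N_def)
  \<comment> \<open>\<open>N i i\<close> says that coordinate \<open>i\<close> vanishes on
    \<open>S\<close>; all such indices are related in both ways.\<close>
  have zero: "N i i \<Longrightarrow> N j j \<Longrightarrow> R i j \<and> N i j" for i j
    by (simp add: R_def N_def)
  have zero_cong: "N i i \<longleftrightarrow> N j j" if "R i j \<or> N i j" for i j
    using that by (auto simp: R_def N_def)
  define lead where "lead i = Min {j. R i j \<or> N i j}" for i
  have lead_in: "R i (lead i) \<or> N i (lead i)" for i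
  proof -
    have "{j. R i j \<or> N i j} \<noteq> {}" using R_refl by blast
    then have "lead i \<in> {j. R i j \<or> N i j}"
      unfolding lead_def by (intro Min_in) simp_all
    then show ?thesis by simp
  qed
  have lead_le: "lead i \<le> i" for i
    unfolding lead_def using R_refl by (intro Min_le) auto
  have lead_eq: "lead i = lead j" if "R i j \<or> N i j" for i j
  proof -
    have "{k. R i k \<or> N i k} = {k. R j k \<or> N j k}"
      using that RR RN NR NN R_sym N_sym by blast
    then show ?thesis by (simp add: lead_def)
  qed
  have lead_lead: "lead (lead i) = lead i" for i
    using lead_eq lead_in by metis
  define L where "L = {l. \<not> N l l \<and> lead l = l}"
  \<comment> \<open>The count includes \<open>l\<close> itself, so leads are numbered from 1 and 0
    stays free for the vanishing coordinates.\<close>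
  define h where "h l = int (card {k\<in>L. k \<le> l})" for l
  have lead_L: "lead i \<in> L" if "\<not> N i i" for i
    using that lead_in lead_lead zero_cong by (auto simp: L_def)
  have h_less: "h k < h l" if "l \<in> L" "k < l" for k l
  proof -
    have "l \<in> {k\<in>L. k \<le> l}" "l \<notin> {m\<in>L. m \<le> k}"
      using that by auto
    then have "{m\<in>L. m \<le> k} \<subset> {k\<in>L. k \<le> l}"
      using \<open>k < l\<close> by fastforce
    then show ?thesis
      unfolding h_def by (simp add: psubset_card_mono)
  qed
  have h_pos: "0 < h l" if "l \<in> L" for l
    unfolding h_def using that by (auto simp: card_gt_0_iff)
  have h_inj: "k = l" if "k \<in> L" "l \<in> L" "h k = h l" for k l
    using that h_less by (metis less_irrefl linorder_neqE)
  \<comment> \<open>By \<open>lead_in\<close>, the last branch means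
    \<open>N i (lead i)\<close>.\<close>
  define c :: "int ^ 'n::{finite,linorder}" where
    "c = (\<chi> i. if N i i then 0 else if R i (lead i) then h (lead i) else - h (lead i))"
  have c: "c $ i = (if N i i then 0 else if R i (lead i) then h (lead i) else - h (lead i))" for i
    by (simp add: c_def)
  have c_L: "c $ l = h l" if "l \<in> L" for l
    using that R_refl by (simp add: c L_def)
  have eq: "c $ i = c $ j \<longleftrightarrow> R i j" for i j
  proof (cases "N i i \<or> N j j")
    case True
    \<comment> \<open>If both coordinates vanish, both sides hold. If only one does,
      \<open>zero_cong\<close> excludes a relation and \<open>h_pos\<close> makes the colors
      differ.\<close>
    then show ?thesis
      using zero zero_cong[of i j] h_pos[OF lead_L, of i] h_pos[OF lead_L, of j] unfolding c
      by (smt (verit))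
  next
    case False
    then have pos: "0 < h (lead i)" "0 < h (lead j)" and L: "lead i \<in> L" "lead j \<in> L"
      using lead_L h_pos by auto
    show ?thesis
    proof
      assume "c $ i = c $ j"
      then have "h (lead i) = h (lead j)" "R i (lead i) \<longleftrightarrow> R j (lead j)"
        using False pos by (auto simp: c split: if_splits)
      then show "R i j"
        using h_inj[OF L] lead_in[of i] lead_in[of j] RR NN R_sym N_sym by metis
    next
      assume "R i j"
      then have "lead i = lead j" "R i (lead i) \<longleftrightarrow> R j (lead j)"
        using lead_eq RR R_sym by metis+
      then show "c $ i = c $ j"
        using False by (simp add: c)
    qed
  qed
  have neg: "c $ i = - c $ j \<longleftrightarrow> N i j" for i j
  proof (cases "N i i \<or> N j j")
    case True
    then show ?thesis
      using zero zero_cong[of i j] h_pos[OF lead_L, of i] h_pos[OF lead_L, of j] unfolding c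
      by (smt (verit))
  next
    case False
    then have pos: "0 < h (lead i)" "0 < h (lead j)" and L: "lead i \<in> L" "lead j \<in> L"
      using lead_L h_pos by auto
    show ?thesis
    proof
      assume "c $ i = - c $ j"
      then have "h (lead i) = h (lead j)" "R i (lead i) \<longleftrightarrow> \<not> R j (lead j)"
        using False pos by (auto simp: c split: if_splits)
      then show "N i j"
        using h_inj[OF L] lead_in[of i] lead_in[of j] RN NR R_sym N_sym by metis
    next
      assume ij: "N i j"
      then have l: "lead i = lead j"
        using lead_eq by blast
      \<comment> \<open>If \<open>i\<close> and \<open>j\<close> had the same sign relative to the
        lead, \<open>R i j\<close> together with \<open>N i j\<close> would give
        \<open>N i i\<close>.\<close>
      have "R i (lead i) \<longleftrightarrow> \<not> R j (lead i)"
        using ij l lead_in[of i] False RR RN NR NN R_sym N_sym by metis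
      then show "c $ i = - c $ j"
        using False l by (simp add: c)
    qed
  qed
  have "- color_max c i \<le> c $ i \<and> c $ i \<le> 1 + color_max c i" for i
  proof (cases "N i i")
    case True
    then show ?thesis using color_max_nonneg[of c i] by (simp add: c)
  next
    case False
    then have L: "lead i \<in> L" by (rule lead_L)
    show ?thesis
    proof (cases "lead i = i")
      case True
      let ?K = "{k\<in>L. k < i}"
      have i: "i \<in> L" using L True by simp
      then have "{k\<in>L. k \<le> i} = insert i ?K" by auto
      then have "c $ i = 1 + int (card ?K)"
        by (simp add: c_L[OF i] h_def)
      moreover have "int (card ?K) \<le> color_max c i"
      proof (cases "?K = {}")
        case True
        then show ?thesis using color_max_nonneg[of c i] by (simp only: card.empty)
      next
        case False
        \<comment> \<open>The last earlier lead carries as its color the number of all earlier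
          leads, so that count is bounded by the running maximum.\<close>
        define k where "k = Max ?K"
        have k: "k \<in> ?K"
          unfolding k_def using False by (intro Max_in) simp_all
        have "?K = {l\<in>L. l \<le> k}"
          using k by (auto simp: k_def)
        then have "int (card ?K) = c $ k"
          using k by (simp add: c_L h_def)
        then show ?thesis using k color_max_ge by auto
      qed
      ultimately show ?thesis by linarith
    next
      case False
      \<comment> \<open>The lead comes strictly before \<open>i\<close> and has color
        \<open>h (lead i)\<close>, which bounds the absolute value of the color of
        \<open>i\<close>.\<close>
      then have "h (lead i) \<le> color_max c i"
        using lead_le[of i] color_max_ge[of "lead i" i c] c_L[OF L] by simp
      moreover have "\<bar>c $ i\<bar> \<le> h (lead i)"
        using h_pos[OF L] by (simp add: c)
      ultimately show ?thesis by linarith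
    qed
  qed
  then have "coloring_vector c"
    by (simp add: coloring_vector_iff)
  then show thesis
    using that eq neg unfolding R_def N_def by blast
qed

section \<open>The bijection\<close>

theorem mainTheorem3:
  fixes \<Delta> :: "int ^ 'n::{finite,linorder} \<Rightarrow> (real ^ 'n::{finite,linorder}) set"
  defines "\<Delta> \<equiv> \<lambda>c. polydiag (color_partition c) (color_tag c)"
  shows "bij_betw \<Delta> {c. coloring_vector c} {S. polydiagonal S} \<and>
         (\<forall>c. coloring_vector c \<longrightarrow>
            \<Delta> c = {x. \<forall>i j. (c $ i = c $ j \<longrightarrow> x $ i = x $ j) \<and>
                               (c $ i = - c $ j \<longrightarrow> x $ i = - x $ j)})"
proof
  have \<Delta>: "\<Delta> c = color_subspace c" for c
    by (simp add: \<Delta>_def polydiag_color)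
  show "\<forall>c. coloring_vector c \<longrightarrow>
            \<Delta> c = {x. \<forall>i j. (c $ i = c $ j \<longrightarrow> x $ i = x $ j) \<and>
                               (c $ i = - c $ j \<longrightarrow> x $ i = - x $ j)}"
    by (simp add: \<Delta> color_subspace_def)
  have "polydiagonal (\<Delta> c)" for c
    unfolding polydiagonal_def \<Delta>_def
    using subspace_polydiag tagged_partition_on_color by blast
  moreover have "S \<in> \<Delta> ` {c. coloring_vector c}" if "polydiagonal S" for S
  proof -
    obtain P s where S: "S = polydiag P s"
      using \<open>polydiagonal S\<close> unfolding polydiagonal_def by blast
    obtain c where c: "coloring_vector c"
      "\<And>i j. c $ i = c $ j \<longleftrightarrow> (\<forall>x\<in>S. x $ i = x $ j)"
      "\<And>i j. c $ i = - c $ j \<longleftrightarrow> (\<forall>x\<in>S. x $ i = - x $ j)"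
      using exists_coloring_vector[of S] by blast
    have "S \<subseteq> color_subspace c"
      unfolding color_subspace_def c by auto
    \<comment> \<open>Each defining equation of \<open>polydiag P s\<close> holds on all of
      \<open>S\<close>, hence is a relation between colors of \<open>c\<close>, hence holds for
      \<open>x\<close>.\<close>
    moreover have "color_subspace c \<subseteq> S"
    proof
      fix x assume x: "x \<in> color_subspace c"
      have "x $ i = x $ j" if "class_of P i = class_of P j" for i j
      proof -
        have "\<forall>y\<in>S. y $ i = y $ j"
          unfolding S polydiag_def using that by blast
        then have "c $ i = c $ j"
          by (rule c(2)[THEN iffD2])
        then show ?thesis
          using x unfolding color_subspace_def by blast
      qed
      moreover have "x $ i = - x $ j" if "s (class_of P i) = Some (class_of P j)" for i j
      proof -
        have "\<forall>y\<in>S. y $ i = - y $ j"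
          unfolding S polydiag_def using that by blast
        then have "c $ i = - c $ j"
          by (rule c(3)[THEN iffD2])
        then show ?thesis
          using x unfolding color_subspace_def by blast
      qed
      ultimately show "x \<in> S"
        unfolding S polydiag_def by blast
    qed
    ultimately show ?thesis
      using c(1) \<Delta> by blast
  qed
  moreover have "inj_on \<Delta> {c. coloring_vector c}"
  proof (rule inj_onI)
    fix c d :: "int ^ 'n::{finite,linorder}"
    assume cd: "c \<in> {c. coloring_vector c}" "d \<in> {c. coloring_vector c}" and "\<Delta> c = \<Delta> d"
    then have eq: "color_subspace c = color_subspace d"
      by (simp add: \<Delta>)
    show "c = d"
    proof (rule coloring_vector_eqI)
      fix i j
      show "c $ i = c $ j \<longleftrightarrow> d $ i = d $ j"
        using color_subspace_eq_iff[of c i j] color_subspace_eq_iff[of d i j] unfolding eq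
        by (rule trans[OF sym])
      show "c $ i = - c $ j \<longleftrightarrow> d $ i = - d $ j"
        using color_subspace_neg_iff[of c i j] color_subspace_neg_iff[of d i j] unfolding eq
        by (rule trans[OF sym])
    qed (use cd in simp_all)
  qed
  ultimately show "bij_betw \<Delta> {c. coloring_vector c} {S. polydiagonal S}"
    unfolding bij_betw_def by blast
qed

end
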